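(* Let $\mathcal A=\{a_1,a_2\}$, let $w=w_0w_1w_2\ldots$ be a one-sided infinite fixed word of a substitution on $\mathcal A$, and let the tile lengths $|I_1|,|I_2|>0$ (for $a_1,a_2$ respectively) be algebraic numbers. Let $0=t_0<t_1<\cdots$ be the geometric realisation of $w$ and $G(X)=\sum_{n\ge0}t_nX^n$. Then exactly one of the following holds: (a) $|I_1|=|I_2|$; in this case $G(X)=\frac{|I_1|X}{(1-X)^2}$. (b) $|I_1|\ne|I_2|$ and $w$ is eventually periodic; in this case there exist $P\in\mathbb{Q}[X]$ and an integer $d\ge1$ such that \[G(X)=(|I_1|-|I_2|)\frac{XP(X)}{(1-X)(1-X^d)}+|I_1|\frac{X}{(1-X)^2}.\] (c) $|I_1|\ne|I_2|$ and $w$ is not eventually periodic; in this case $G(X)$ is transcendental over $\mathbb{Q}(X)$.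
   Context: The geometric realisation of $w$: replace each letter $w_n=a_j$ by a translated copy of an interval $I_j$ of length $|I_j|$, placed consecutively starting at the origin and proceeding to the right with no gaps, in the order $w_0,w_1,\dots$; $t_n$ is the left endpoint of the interval corresponding to $w_n$. A word is eventually periodic if there exist $N$, $d\ge1$ with $w_{n+d}=w_n$ for all $n\ge N$. Transcendence over $\mathbb{Q}(X)$ is meant inside $\mathbb{C}((X))$. *)

theory Defs
  imports Complex_Main "HOL-Computational_Algebra.Polynomial" "HOL-Computational_Algebra.Formal_Power_Series"
    "HOL-Computational_Algebra.Polynomial_FPS"
begin

datatype letter = a1 | a2

definition substitution :: "(letter \<Rightarrow> letter list) \<Rightarrow> bool" where
  "substitution \<sigma> \<longleftrightarrow> (\<forall>a. \<sigma> a \<noteq> [])"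

text \<open>One-sided infinite word w (a map nat => letter) is a fixed word of \<sigma>: \<sigma>(w) = w,
  i.e. every block sigma(w_0)...sigma(w_{n-1}) is a prefix of w.\<close>
definition fixed_word :: "(letter \<Rightarrow> letter list) \<Rightarrow> (nat \<Rightarrow> letter) \<Rightarrow> bool" where
  "fixed_word \<sigma> w \<longleftrightarrow> substitution \<sigma> \<and>
     (\<forall>n. let u = concat (map (\<sigma> \<circ> w) [0..<n]) in u = map w [0..<length u])"

definition eventually_periodic :: "(nat \<Rightarrow> 'a) \<Rightarrow> bool" where
  "eventually_periodic w \<longleftrightarrow> (\<exists>N d. d \<ge> 1 \<and> (\<forall>n\<ge>N. w (n + d) = w n))"

definition tile_len :: "real \<Rightarrow> real \<Rightarrow> letter \<Rightarrow> real" where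
  "tile_len L1 L2 a = (case a of a1 \<Rightarrow> L1 | a2 \<Rightarrow> L2)"

text \<open>Geometric realisation: t_n = left endpoint of the n-th tile.\<close>
definition geom_real :: "real \<Rightarrow> real \<Rightarrow> (nat \<Rightarrow> letter) \<Rightarrow> nat \<Rightarrow> real" where
  "geom_real L1 L2 w n = (\<Sum>k<n. tile_len L1 L2 (w k))"

definition gen_series :: "real \<Rightarrow> real \<Rightarrow> (nat \<Rightarrow> letter) \<Rightarrow> complex fps" where
  "gen_series L1 L2 w = Abs_fps (\<lambda>n. complex_of_real (geom_real L1 L2 w n))"

definition transcendental_QX :: "complex fps \<Rightarrow> bool" where
  "transcendental_QX G \<longleftrightarrow>
     \<not> (\<exists>P :: rat poly poly. P \<noteq> 0 \<and>
           poly (map_poly (\<lambda>q. fps_of_poly (map_poly of_rat q)) P) G = 0)"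

end

theory Submission
  imports Defs "HOL-Library.FuncSet"
begin

text \<open>
  Up to rational functions and a factor \<open>|I\<^sub>1| - |I\<^sub>2|\<close>, the series \<open>G\<close> is the generating
  series \<open>f\<close> of the indicator of one letter. If \<open>G\<close> is algebraic, the derivatives of \<open>f\<close> span a
  finite-dimensional space over the rational functions, so \<open>f\<close> satisfies a linear differential
  equation of some order \<open>K\<close> with polynomial coefficients. Dividing the resulting recurrence for the
  coefficients of \<open>f\<close> by \<open>n\<^sup>K\<close>, only the contribution of the leading coefficient survives:
  a fixed linear combination of consecutive coefficients tends to \<open>0\<close>. As it takes finitely many
  values, it vanishes eventually. So \<open>f\<close> satisfies a linear recurrence with constant coefficients,
  and a sequence over a finite alphabet with this property is eventually periodic.
\<close>

section \<open>Linear systems over an integral domain\<close>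

text \<open>Gaussian elimination without division, so that the solution stays in the domain; it is
  applied to polynomial entries. \<open>M k i\<close> is the coefficient of unknown \<open>k\<close>
  in equation \<open>i\<close>.\<close>

lemma homogeneous_system_nontrivial_solution:
  fixes M :: "'b \<Rightarrow> nat \<Rightarrow> 'a::idom"
  assumes "finite A" "d < card A"
  shows "\<exists>x. (\<exists>k\<in>A. x k \<noteq> 0) \<and> (\<forall>i<d. (\<Sum>k\<in>A. x k * M k i) = 0)"
  using assms
proof (induction d arbitrary: A M)
  case 0
  then have "A \<noteq> {}" by auto
  then show ?case by (intro exI[of _ "\<lambda>_. 1"]) auto
next
  case (Suc d)
  show ?case
  proof (cases "\<exists>p\<in>A. M p d \<noteq> 0")
    case False
    obtain x where "\<exists>k\<in>A. x k \<noteq> 0" "\<forall>i<d. (\<Sum>k\<in>A. x k * M k i) = 0"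
      using Suc.IH[of A M] Suc.prems by auto
    with False show ?thesis
      by (intro exI[of _ x]) (auto simp: less_Suc_eq)
  next
    case True
    then obtain p where p: "p \<in> A" "M p d \<noteq> 0" by blast
    define B where "B = A - {p}"
    have B: "finite B" "d < card B" "A = insert p B" "p \<notin> B"
      using Suc.prems p by (auto simp: B_def)
    obtain y where y: "\<exists>k\<in>B. y k \<noteq> 0"
      "\<And>i. i < d \<Longrightarrow> (\<Sum>k\<in>B. y k * (M p d * M k i - M k d * M p i)) = 0"
      using Suc.IH[of B "\<lambda>k i. M p d * M k i - M k d * M p i"] B by auto
    \<comment> \<open>Scaling \<open>y\<close> by the pivot \<open>M p d\<close> makes equation
      \<open>d\<close> solvable for the unknown \<open>p\<close> without a quotient. In
      \<open>sum_x\<close> the bracket is identically zero for \<open>i = d\<close>.\<close>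
    define x where "x k = (if k = p then - (\<Sum>k\<in>B. y k * M k d) else M p d * y k)" for k
    have sum_x: "(\<Sum>k\<in>A. x k * M k i) = (\<Sum>k\<in>B. y k * (M p d * M k i - M k d * M p i))" for i
    proof -
      have "(\<Sum>k\<in>B. x k * M k i) = (\<Sum>k\<in>B. M p d * y k * M k i)"
        using B(4) by (intro sum.cong) (auto simp: x_def)
      then show ?thesis
        using B by (simp add: x_def[of p] sum_distrib_left sum_subtractf algebra_simps)
    qed
    have "\<exists>k\<in>A. x k \<noteq> 0"
      using y(1) p B by (auto simp: x_def)
    moreover have "(\<Sum>k\<in>A. x k * M k i) = 0" if "i < Suc d" for i
      using that y(2)[of i] unfolding sum_x by (cases "i = d") (auto simp: algebra_simps)
    ultimately show ?thesis by blast
  qed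
qed

section \<open>The ring generated by a power series over the polynomials\<close>

text \<open>\<open>Q\<close> is read as a polynomial in Y over the polynomials in X, evaluated at Y
  = \<open>g\<close>. The range over all \<open>Q\<close> is the ring generated by \<open>g\<close>
  over the polynomials.\<close>

definition poly_eval_fps :: "'a::field_char_0 fps \<Rightarrow> 'a poly poly \<Rightarrow> 'a fps" where
  "poly_eval_fps g Q = poly (map_poly fps_of_poly Q) g"

lemma poly_eval_fps_0 [simp]: "poly_eval_fps g 0 = 0"
  by (simp add: poly_eval_fps_def)

lemma poly_eval_fps_pCons [simp]:
  "poly_eval_fps g (pCons a Q) = fps_of_poly a + g * poly_eval_fps g Q"
  by (simp add: poly_eval_fps_def map_poly_pCons)

lemma poly_eval_fps_add: "poly_eval_fps g (P + Q) = poly_eval_fps g P + poly_eval_fps g Q"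
  by (induction P Q rule: poly_induct2) (simp_all add: fps_of_poly_add algebra_simps)

lemma poly_eval_fps_smult: "poly_eval_fps g (smult a Q) = fps_of_poly a * poly_eval_fps g Q"
  by (induction Q) (simp_all add: fps_of_poly_mult algebra_simps)

lemma poly_eval_fps_mult: "poly_eval_fps g (P * Q) = poly_eval_fps g P * poly_eval_fps g Q"
  by (induction P) (simp_all add: poly_eval_fps_add poly_eval_fps_smult algebra_simps)

lemma poly_eval_fps_uminus: "poly_eval_fps g (- Q) = - poly_eval_fps g Q"
  by (induction Q) (simp_all add: fps_of_poly_uminus algebra_simps)

lemma poly_eval_fps_sum: "poly_eval_fps g (\<Sum>k\<in>A. F k) = (\<Sum>k\<in>A. poly_eval_fps g (F k))"
  by (induction A rule: infinite_finite_induct) (simp_all add: poly_eval_fps_add)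

text \<open>Chain rule: \<open>map_poly pderiv\<close> is the partial derivative in X,
  \<open>pderiv\<close> the one in Y.\<close>

lemma fps_deriv_poly_eval_fps:
  "fps_deriv (poly_eval_fps g Q) =
     poly_eval_fps g (map_poly pderiv Q) + poly_eval_fps g (pderiv Q) * fps_deriv g"
  by (induction Q)
     (simp_all add: map_poly_pCons pderiv_pCons fps_of_poly_pderiv poly_eval_fps_add algebra_simps)

lemma poly_eval_fps_closed:
  defines "S \<equiv> \<lambda>g. range (poly_eval_fps g)"
  shows "fps_of_poly q \<in> S g" "g \<in> S g"
    and "s \<in> S g \<Longrightarrow> t \<in> S g \<Longrightarrow> s + t \<in> S g"
    and "s \<in> S g \<Longrightarrow> t \<in> S g \<Longrightarrow> s * t \<in> S g"
    and "s \<in> S g \<Longrightarrow> t \<in> S g \<Longrightarrow> s - t \<in> S g"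
    and "s \<in> S g \<Longrightarrow> s ^ n \<in> S g"
proof -
  show poly: "fps_of_poly q \<in> S g" for q
    unfolding S_def by (rule range_eqI[of _ _ "[:q:]"]) simp
  show "g \<in> S g"
    unfolding S_def by (rule range_eqI[of _ _ "[:0, 1:]"]) simp
  show add: "s + t \<in> S g" if "s \<in> S g" "t \<in> S g" for s t
    using that by (auto simp: S_def simp flip: poly_eval_fps_add)
  show mult: "s * t \<in> S g" if "s \<in> S g" "t \<in> S g" for s t
    using that by (auto simp: S_def simp flip: poly_eval_fps_mult)
  show "s - t \<in> S g" if "s \<in> S g" "t \<in> S g"
    using add[OF that(1) mult[OF poly[of "-1"] that(2)]] by (simp add: fps_of_poly_uminus)
  show "s ^ n \<in> S g" if "s \<in> S g"
    by (induction n) (use poly[of 1] mult that in auto)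
qed

text \<open>In the chain rule only the factor \<open>fps_deriv g\<close> can leave the ring, and
  \<open>D\<close> is a denominator for it. So \<open>D\<close> times differentiation is a
  derivation of the ring into itself.\<close>

lemma poly_eval_fps_derivation_closed:
  assumes "D \<in> range (poly_eval_fps g)" "D * fps_deriv g \<in> range (poly_eval_fps g)"
    and "s \<in> range (poly_eval_fps g)"
  shows "D * fps_deriv s \<in> range (poly_eval_fps g)"
proof -
  obtain Q where Q: "s = poly_eval_fps g Q" using assms(3) by blast
  have "D * fps_deriv s = D * poly_eval_fps g (map_poly pderiv Q)
      + poly_eval_fps g (pderiv Q) * (D * fps_deriv g)"
    by (simp add: Q fps_deriv_poly_eval_fps algebra_simps)
  also have "\<dots> \<in> range (poly_eval_fps g)"
    by (rule poly_eval_fps_closed(3)[OF poly_eval_fps_closed(4)[OF assms(1) rangeI]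
          poly_eval_fps_closed(4)[OF rangeI assms(2)]])
  finally show ?thesis .
qed

text \<open>Each differentiation costs two more factors \<open>D\<close>: one from the quotient rule, one from the
  denominator of \<open>g'\<close>.\<close>

lemma iterated_fps_deriv_denominator:
  fixes g h :: "'a::field_char_0 fps"
  assumes D: "D \<in> range (poly_eval_fps g)" "D * fps_deriv g \<in> range (poly_eval_fps g)"
    and h: "D * h \<in> range (poly_eval_fps g)"
  shows "D ^ (2 * k + 1) * (fps_deriv ^^ k) h \<in> range (poly_eval_fps g)"
proof (induction k)
  case 0
  then show ?case using h by simp
next
  case (Suc k)
  define u a c where "u = (fps_deriv ^^ k) h" and "a = D ^ (2 * k)"
    and "c = fps_of_poly [:of_nat (2 * k + 1) :: 'a:]"
  define s where "s = D * a * u"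
  have s: "s \<in> range (poly_eval_fps g)"
    using Suc by (simp add: s_def u_def a_def)
  have "fps_deriv (D ^ (2 * k + 1)) = c * fps_deriv D * a"
    by (simp only: fps_deriv_power c_def fps_of_poly_const a_def diff_add_inverse2)
  then have "fps_deriv (D * a) = c * fps_deriv D * a"
    by (simp only: a_def power_add power_one_right mult.commute)
  then have deriv_s: "fps_deriv s = c * fps_deriv D * a * u + D * a * fps_deriv u"
    by (simp only: s_def fps_deriv_mult add.commute)
  \<comment> \<open>The product rule for \<open>s\<close> is solved for \<open>fps_deriv u\<close>.
    The two new factors \<open>D\<close> make both remaining terms images of \<open>D\<close> times
    differentiation, up to ring factors.\<close>
  have "D ^ (2 * Suc k + 1) * fps_deriv u = D * D * (D * a) * fps_deriv u"
    by (simp add: a_def)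
  also have "\<dots> = D * (D * fps_deriv s) - c * ((D * fps_deriv D) * s)"
    unfolding deriv_s by (simp only: s_def ring_distribs mult_ac add_diff_cancel_left')
  also have "\<dots> \<in> range (poly_eval_fps g)"
    unfolding c_def
    using poly_eval_fps_derivation_closed[OF D s] poly_eval_fps_derivation_closed[OF D D(1)] D(1) s
    by (simp add: poly_eval_fps_closed)
  finally show ?case by (simp add: u_def)
qed

section \<open>From an algebraic equation to a linear differential equation\<close>

text \<open>After multiplication by a common denominator, the derivatives of \<open>h\<close> of
  order 0 to d lie in the ring of \<open>g\<close>. Reduced modulo a minimal equation of degree d,
  they become d + 1 vectors of length d, hence are linearly dependent over the polynomials. The
  factor \<open>e\<close> is a denominator of \<open>h\<close>.\<close>

lemma algebraic_fps_imp_linear_ode: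
  fixes g h :: "'a::field_char_0 fps"
  assumes alg: "P \<noteq> 0" "poly_eval_fps g P = 0"
    and h: "e \<noteq> 0" "e \<in> range (poly_eval_fps g)" "e * h \<in> range (poly_eval_fps g)"
  shows "\<exists>(c :: nat \<Rightarrow> 'a poly) d. (\<exists>k\<le>d. c k \<noteq> 0) \<and>
           (\<Sum>k\<le>d. fps_of_poly (c k) * (fps_deriv ^^ k) h) = 0"
proof -
  obtain R where R: "R \<noteq> 0" "poly_eval_fps g R = 0"
    and min: "\<And>Q. Q \<noteq> 0 \<Longrightarrow> poly_eval_fps g Q = 0 \<Longrightarrow> degree R \<le> degree Q"
    using ex_has_least_nat[of "\<lambda>Q. Q \<noteq> 0 \<and> poly_eval_fps g Q = 0" P degree] alg by blast
  have "degree R \<noteq> 0"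
  proof
    assume "degree R = 0"
    then obtain a where "R = [:a:]" by (rule degree_eq_zeroE)
    with R show False by auto
  qed
  \<comment> \<open>\<open>D0\<close> is the Y-derivative of the minimal equation at
    \<open>g\<close>. It is nonzero because \<open>pderiv R\<close> is nonzero of smaller degree;
    differentiating the equation shows that \<open>D0\<close> is a denominator of
    \<open>fps_deriv g\<close>.\<close>
  define D0 where "D0 = poly_eval_fps g (pderiv R)"
  have "D0 \<noteq> 0"
    using min[of "pderiv R"] \<open>degree R \<noteq> 0\<close>
    by (auto simp: D0_def pderiv_eq_0_iff degree_pderiv)
  have D0': "D0 * fps_deriv g = poly_eval_fps g (- map_poly pderiv R)"
    using fps_deriv_poly_eval_fps[of g R] R(2)
    by (simp add: D0_def poly_eval_fps_uminus eq_neg_iff_add_eq_0 add.commute)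
  \<comment> \<open>One denominator for both \<open>fps_deriv g\<close> and
    \<open>h\<close>.\<close>
  define D where "D = e * D0"
  have "D \<noteq> 0" using \<open>D0 \<noteq> 0\<close> h by (simp add: D_def)
  have D: "D \<in> range (poly_eval_fps g)"
    unfolding D_def D0_def by (rule poly_eval_fps_closed(4)[OF h(2) rangeI])
  have D': "D * fps_deriv g \<in> range (poly_eval_fps g)"
    unfolding D_def mult.assoc D0' by (rule poly_eval_fps_closed(4)[OF h(2) rangeI])
  have Dh: "D * h \<in> range (poly_eval_fps g)"
  proof -
    have "D0 * (e * h) \<in> range (poly_eval_fps g)"
      unfolding D0_def by (rule poly_eval_fps_closed(4)[OF rangeI h(3)])
    then show ?thesis by (simp add: D_def mult_ac)
  qed
  define d where "d = degree R"
  \<comment> \<open>The exponent \<open>2 * d + 1\<close> serves all orders up to \<open>d\<close>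
    at once. Pseudo-division by \<open>R\<close> replaces inverting its leading coefficient by the
    factor \<open>a\<close>.\<close>
  have "\<exists>r a. a \<noteq> 0 \<and> (\<forall>i\<ge>d. coeff r i = 0) \<and>
      fps_of_poly a * (D ^ (2 * d + 1) * (fps_deriv ^^ k) h) = poly_eval_fps g r" if "k \<le> d" for k
  proof -
    have "D ^ (2 * (d - k)) * (D ^ (2 * k + 1) * (fps_deriv ^^ k) h) \<in> range (poly_eval_fps g)"
      by (intro poly_eval_fps_closed(4) poly_eval_fps_closed(6) D
          iterated_fps_deriv_denominator[OF D D' Dh])
    moreover have "2 * (d - k) + (2 * k + 1) = 2 * d + 1" using that by simp
    ultimately have "D ^ (2 * d + 1) * (fps_deriv ^^ k) h \<in> range (poly_eval_fps g)"
      by (simp only: power_add[symmetric] mult.assoc[symmetric])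
    then obtain Q where Q: "D ^ (2 * d + 1) * (fps_deriv ^^ k) h = poly_eval_fps g Q" by blast
    obtain q r where qr: "pseudo_divmod Q R = (q, r)" by (cases "pseudo_divmod Q R")
    define a where "a = lead_coeff R ^ (Suc (degree Q) - degree R)"
    have *: "smult a Q = R * q + r" "r = 0 \<or> degree r < degree R"
      using pseudo_divmod[OF R(1) qr] by (simp_all add: a_def)
    have "fps_of_poly a * poly_eval_fps g Q = poly_eval_fps g r"
      using arg_cong[OF *(1), of "poly_eval_fps g"] R(2)
      by (simp add: poly_eval_fps_smult poly_eval_fps_add poly_eval_fps_mult)
    moreover have "\<forall>i\<ge>d. coeff r i = 0" using *(2) by (auto simp: d_def coeff_eq_0)
    moreover have "a \<noteq> 0" using R(1) by (simp add: a_def)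
    ultimately show ?thesis unfolding Q by blast
  qed
  then obtain r a where ra: "\<And>k. k \<le> d \<Longrightarrow> a k \<noteq> 0"
    "\<And>k i. k \<le> d \<Longrightarrow> i \<ge> d \<Longrightarrow> coeff (r k) i = 0"
    "\<And>k. k \<le> d \<Longrightarrow> fps_of_poly (a k) * (D ^ (2 * d + 1) * (fps_deriv ^^ k) h) = poly_eval_fps g (r k)"
    by metis
  \<comment> \<open>There are \<open>d + 1\<close> unknowns and only \<open>d\<close> equations, one
    for each power of Y below \<open>d\<close>.\<close>
  obtain x where x: "\<exists>k\<le>d. x k \<noteq> 0" "\<And>i. i < d \<Longrightarrow> (\<Sum>k\<le>d. x k * coeff (r k) i) = 0"
    using homogeneous_system_nontrivial_solution[of "{..d}" d "\<lambda>k. coeff (r k)"] by auto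
  have "(\<Sum>k\<le>d. smult (x k) (r k)) = 0"
  proof (rule poly_eqI)
    fix i show "coeff (\<Sum>k\<le>d. smult (x k) (r k)) i = coeff 0 i"
      using x(2)[of i] ra(2) by (cases "i < d") (simp_all add: coeff_sum)
  qed
  then have "0 = (\<Sum>k\<le>d. fps_of_poly (x k) * poly_eval_fps g (r k))"
    using poly_eval_fps_sum[of g "\<lambda>k. smult (x k) (r k)" "{..d}"] by (simp add: poly_eval_fps_smult)
  also have "\<dots> = (\<Sum>k\<le>d. D ^ (2 * d + 1) * (fps_of_poly (x k * a k) * (fps_deriv ^^ k) h))"
    by (intro sum.cong refl) (simp add: ra(3)[symmetric] fps_of_poly_mult mult_ac del: power_Suc)
  also have "\<dots> = D ^ (2 * d + 1) * (\<Sum>k\<le>d. fps_of_poly (x k * a k) * (fps_deriv ^^ k) h)"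
    by (simp only: sum_distrib_left)
  finally have "(\<Sum>k\<le>d. fps_of_poly (x k * a k) * (fps_deriv ^^ k) h) = 0"
    using \<open>D \<noteq> 0\<close> by (simp only: mult_eq_0_iff power_eq_0_iff eq_commute[of 0]) simp
  then show ?thesis using x(1) ra(1)
    by (intro exI[of _ "\<lambda>k. x k * a k"] exI[of _ d]) auto
qed

section \<open>Asymptotics of the coefficient recurrence\<close>

lemma fps_nth_iterated_deriv:
  "fps_nth ((fps_deriv ^^ k) f) n = pochhammer (of_nat n + 1) k * fps_nth f (n + k)"
  for f :: "'a::comm_ring_1 fps"
proof (induction k arbitrary: n)
  case (Suc k)
  show ?case
    by (simp add: Suc pochhammer_rec algebra_simps)
qed simp

lemma fps_nth_fps_of_poly_mult:
  fixes f :: "'a::comm_semiring_1 fps"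
  assumes "degree q \<le> n"
  shows "fps_nth (fps_of_poly q * f) n = (\<Sum>i\<le>degree q. coeff q i * fps_nth f (n - i))"
proof -
  have "(\<Sum>i=0..n. coeff q i * fps_nth f (n - i)) = (\<Sum>i\<le>degree q. coeff q i * fps_nth f (n - i))"
    using assms by (intro sum.mono_neutral_right) (auto simp: coeff_eq_0)
  then show ?thesis by (simp add: fps_mult_nth)
qed

text \<open>Each of the \<open>k\<close> factors is \<open>n\<close> plus a constant once
  \<open>n \<ge> i\<close>, where the truncated difference \<open>n - i\<close> is exact.\<close>

lemma pochhammer_asymp_power:
  "(\<lambda>n. pochhammer (of_nat (n - i) + 1) k / of_nat n ^ k :: complex) \<longlonglongrightarrow> 1"
proof (induction k)
  case (Suc k)
  have "(\<lambda>n. 1 + (1 + of_nat k - of_nat i) / of_nat n :: complex) \<longlonglongrightarrow> 1 + 0"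
    by (intro tendsto_add tendsto_const lim_const_over_n)
  moreover have "\<forall>\<^sub>F n in sequentially. 1 + (1 + of_nat k - of_nat i) / of_nat n
      = (of_nat (n - i) + 1 + of_nat k) / (of_nat n :: complex)"
    using eventually_ge_at_top[of "Suc i"]
    by eventually_elim (simp add: of_nat_diff field_simps)
  ultimately have "(\<lambda>n. (of_nat (n - i) + 1 + of_nat k) / (of_nat n :: complex)) \<longlonglongrightarrow> 1"
    by (simp add: tendsto_cong)
  from tendsto_mult[OF Suc this] show ?case
    by (simp add: pochhammer_Suc mult_ac)
qed simp

text \<open>Order \<open>k\<close> contributes to the \<open>n\<close>-th coefficient with weights
  of size n^k. Since the coefficients of \<open>f\<close> are bounded, division by n^K kills all
  orders below \<open>K\<close> and turns the weights of order \<open>K\<close> into 1 up to a null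
  sequence.\<close>

lemma fps_linear_ode_leading_coeff_tendsto:
  fixes f :: "complex fps"
  assumes bound: "\<And>n. norm (fps_nth f n) \<le> B"
    and ode: "(\<Sum>k\<le>K. fps_of_poly (c k) * (fps_deriv ^^ k) f) = 0"
  shows "(\<lambda>n. \<Sum>i\<le>degree (c K). coeff (c K) i * fps_nth f (n - i + K)) \<longlonglongrightarrow> 0"
proof -
  define T where "T k n = (\<Sum>i\<le>degree (c k). coeff (c k) i *
      (pochhammer (of_nat (n - i) + 1) k / of_nat n ^ K * fps_nth f (n - i + k)))" for k n
  have pert: "(\<lambda>n. \<Sum>i\<le>degree (c k). coeff (c k) i * (u i n * fps_nth f (n - i + k))) \<longlonglongrightarrow> 0"
    if "\<And>i. u i \<longlonglongrightarrow> 0" for u k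
  proof (intro tendsto_null_sum tendsto_mult_right_zero)
    fix i
    show "(\<lambda>n. u i n * fps_nth f (n - i + k)) \<longlonglongrightarrow> 0"
      by (rule tendsto_0_le[OF that[of i], of _ B])
         (auto simp: norm_mult intro!: always_eventually mult_left_mono bound)
  qed
  have lower: "T k \<longlonglongrightarrow> 0" if "k < K" for k
    unfolding T_def
  proof (rule pert)
    fix i
    have "(\<lambda>n. pochhammer (of_nat (n - i) + 1) k / of_nat n ^ k * (1 / of_nat n) ^ (K - k) :: complex) \<longlonglongrightarrow> 1 * 0 ^ (K - k)"
      by (intro tendsto_mult tendsto_power pochhammer_asymp_power lim_1_over_n)
    then show "(\<lambda>n. pochhammer (of_nat (n - i) + 1) k / of_nat n ^ K :: complex) \<longlonglongrightarrow> 0"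
      using that by (simp add: power_divide zero_power flip: power_add)
  qed
  have top: "(\<lambda>n. T K n - (\<Sum>i\<le>degree (c K). coeff (c K) i * fps_nth f (n - i + K))) \<longlonglongrightarrow> 0"
  proof -
    have "(\<lambda>n. \<Sum>i\<le>degree (c K). coeff (c K) i * ((pochhammer (of_nat (n - i) + 1) K / of_nat n ^ K - 1)
        * fps_nth f (n - i + K))) \<longlonglongrightarrow> 0"
    proof (rule pert)
      show "(\<lambda>n. pochhammer (of_nat (n - i) + 1) K / of_nat n ^ K - 1 :: complex) \<longlonglongrightarrow> 0" for i
        using tendsto_diff[OF pochhammer_asymp_power tendsto_const[of 1]] by simp
    qed
    then show ?thesis
      by (simp add: T_def left_diff_distrib right_diff_distrib sum_subtractf)
  qed
  \<comment> \<open>From the largest degree on, each convolution contains all coefficients of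
    \<open>c k\<close>, so the \<open>T k n\<close> are exactly the scaled summands of the
    equation.\<close>
  define N where "N = Max ((\<lambda>k. degree (c k)) ` {..K})"
  have N: "degree (c k) \<le> N" if "k \<le> K" for k
    using that by (auto simp: N_def)
  have zero: "(\<Sum>k\<le>K. T k n) = 0" if "n \<ge> N" for n
  proof -
    have "(\<Sum>k\<le>K. T k n) = (\<Sum>k\<le>K. fps_nth (fps_of_poly (c k) * (fps_deriv ^^ k) f) n / of_nat n ^ K)"
    proof (intro sum.cong refl)
      fix k assume "k \<in> {..K}"
      then have "degree (c k) \<le> n" using N[of k] that by simp
      then show "T k n = fps_nth (fps_of_poly (c k) * (fps_deriv ^^ k) f) n / of_nat n ^ K"
        by (simp add: T_def fps_nth_fps_of_poly_mult fps_nth_iterated_deriv sum_divide_distrib)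
    qed
    also have "\<dots> = fps_nth (\<Sum>k\<le>K. fps_of_poly (c k) * (fps_deriv ^^ k) f) n / of_nat n ^ K"
      by (simp add: fps_sum_nth sum_divide_distrib)
    finally show ?thesis by (simp add: ode)
  qed
  \<comment> \<open>As the \<open>T k n\<close> sum to zero, the leading sum is minus the lower
    orders minus the error in \<open>top\<close>; both tend to zero.\<close>
  have "(\<lambda>n. - (\<Sum>k<K. T k n) - (T K n - (\<Sum>i\<le>degree (c K). coeff (c K) i * fps_nth f (n - i + K)))) \<longlonglongrightarrow> - 0 - 0"
    using lower by (intro tendsto_diff tendsto_minus top tendsto_null_sum) auto
  moreover have "\<forall>\<^sub>F n in sequentially. - (\<Sum>k<K. T k n) - (T K n - (\<Sum>i\<le>degree (c K). coeff (c K) i * fps_nth f (n - i + K)))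
      = (\<Sum>i\<le>degree (c K). coeff (c K) i * fps_nth f (n - i + K))"
    using eventually_ge_at_top[of N]
  proof eventually_elim
    case (elim n)
    have "(\<Sum>k\<le>K. T k n) = (\<Sum>k<K. T k n) + T K n"
      by (simp flip: lessThan_Suc_atMost)
    with zero[OF elim] show ?case by (simp add: algebra_simps eq_neg_iff_add_eq_0)
  qed
  ultimately show ?thesis
    by (simp add: tendsto_cong)
qed

section \<open>Eventual periodicity\<close>

text \<open>By pigeonhole two windows of length \<open>r\<close> beyond \<open>N\<close> agree;
  determinism then propagates the agreement to all later positions, and the distance of the windows
  is a period.\<close>

lemma deterministic_window_imp_eventually_periodic:
  fixes b :: "nat \<Rightarrow> 'a"
  assumes fin: "finite (range b)"
    and det: "\<And>m n. m \<ge> N \<Longrightarrow> n \<ge> N \<Longrightarrow> (\<And>i. i < r \<Longrightarrow> b (m + i) = b (n + i)) \<Longrightarrow> b (m + r) = b (n + r)"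
  shows "eventually_periodic b"
proof -
  define s where "s n = map (\<lambda>i. b (n + i)) [0..<r]" for n
  have "s ` {N..} \<subseteq> {xs. set xs \<subseteq> range b \<and> length xs = r}"
    by (auto simp: s_def)
  then have "finite (s ` {N..})"
    using finite_lists_length_eq[OF fin] finite_subset by blast
  then have "\<not> inj_on s {N..}"
    using finite_imageD infinite_Ici by blast
  then obtain m n where mn: "m \<ge> N" "n \<ge> N" "m < n" "s m = s n"
    unfolding inj_on_def by (metis atLeast_iff linorder_neqE_nat)
  have eq: "b (m + i) = b (n + i)" for i
  proof (induction i rule: less_induct)
    case (less i)
    show ?case
    proof (cases "i < r")
      case True
      then show ?thesis using mn(4) by (auto simp: s_def list_eq_iff_nth_eq)
    next
      case False
      have "b (m + (i - r) + r) = b (n + (i - r) + r)"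
      proof (rule det)
        show "b (m + (i - r) + j) = b (n + (i - r) + j)" if "j < r" for j
          using less[of "i - r + j"] that False by (simp add: add.assoc)
      qed (use mn in auto)
      then show ?thesis using False by simp
    qed
  qed
  show ?thesis
    unfolding eventually_periodic_def
  proof (rule exI[of _ m], rule exI[of _ "n - m"], intro conjI allI impI)
    show "1 \<le> n - m" using mn by simp
    fix k assume "m \<le> k"
    then show "b (k + (n - m)) = b k"
      using eq[of "k - m"] mn by (simp add: algebra_simps)
  qed
qed

text \<open>The combination \<open>v\<close> given by the leading coefficient is a null sequence
  with finitely many values, so it vanishes eventually. This is a constant-coefficient recurrence,
  in which each term is determined by a fixed number of predecessors.\<close>

lemma finite_range_linear_ode_imp_eventually_periodic:
  fixes f :: "complex fps"
  assumes fin: "finite (range (fps_nth f))"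
    and nz: "\<exists>k\<le>d. c k \<noteq> 0"
    and ode: "(\<Sum>k\<le>d. fps_of_poly (c k) * (fps_deriv ^^ k) f) = 0"
  shows "eventually_periodic (fps_nth f)"
proof -
  define K where "K = Max {k. k \<le> d \<and> c k \<noteq> 0}"
  have K: "K \<le> d" "c K \<noteq> 0"
    using nz Max_in[of "{k. k \<le> d \<and> c k \<noteq> 0}"] by (auto simp: K_def)
  have Kmax: "c k = 0" if "K < k" "k \<le> d" for k
  proof (rule ccontr)
    assume "c k \<noteq> 0"
    then have "k \<le> K" unfolding K_def using that(2) by (intro Max_ge) auto
    with that(1) show False by simp
  qed
  have "(\<Sum>k\<le>d. fps_of_poly (c k) * (fps_deriv ^^ k) f) = (\<Sum>k\<le>K. fps_of_poly (c k) * (fps_deriv ^^ k) f)"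
    using K Kmax by (intro sum.mono_neutral_right) auto
  with ode have odeK: "(\<Sum>k\<le>K. fps_of_poly (c k) * (fps_deriv ^^ k) f) = 0" by simp
  have B: "norm (fps_nth f n) \<le> Max (norm ` range (fps_nth f))" for n
    using fin by (intro Max_ge) auto
  define q where "q = c K"
  define M where "M = degree q"
  define v where "v n = (\<Sum>i\<le>M. coeff q i * fps_nth f (n - i + K))" for n
  have "v \<longlonglongrightarrow> 0"
    using fps_linear_ode_leading_coeff_tendsto[OF B odeK] by (simp add: v_def[abs_def] M_def q_def)
  moreover have "finite (range v)"
  proof (rule finite_subset)
    show "range v \<subseteq> (\<lambda>s. \<Sum>i\<le>M. coeff q i * s i) ` (PiE {..M} (\<lambda>_. range (fps_nth f)))"
    proof
      fix x assume "x \<in> range v"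
      then obtain n where "x = v n" by blast
      then show "x \<in> (\<lambda>s. \<Sum>i\<le>M. coeff q i * s i) ` (PiE {..M} (\<lambda>_. range (fps_nth f)))"
        by (intro image_eqI[of _ _ "restrict (\<lambda>i. fps_nth f (n - i + K)) {..M}"])
           (auto simp: v_def)
    qed
    show "finite ((\<lambda>s. \<Sum>i\<le>M. coeff q i * s i) ` (PiE {..M} (\<lambda>_. range (fps_nth f))))"
      by (intro finite_imageI finite_PiE fin) auto
  qed
  \<comment> \<open>The finitely many nonzero values of \<open>v\<close> form a closed set, whose
    complement is a neighbourhood of 0.\<close>
  ultimately have "\<forall>\<^sub>F n in sequentially. v n \<in> - (range v - {0})"
    by (intro topological_tendstoD open_Compl finite_imp_closed) auto
  then obtain N where N: "\<And>n. n \<ge> N \<Longrightarrow> v n = 0"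
    by (auto simp: eventually_sequentially)
  \<comment> \<open>The lowest nonzero coefficient of \<open>q\<close> multiplies the term of
    largest index, so the recurrence can be solved for the newest term. The other indices run from
    \<open>n\<close> to \<open>n + (M - j) - 1\<close>, a window of length
    \<open>M - j\<close>.\<close>
  define j where "j = (LEAST i. coeff q i \<noteq> 0)"
  have "\<exists>i. coeff q i \<noteq> 0" using K(2) by (metis q_def leading_coeff_0_iff)
  then have j: "coeff q j \<noteq> 0" "\<And>i. i < j \<Longrightarrow> coeff q i = 0"
    unfolding j_def by (rule LeastI_ex) (use not_less_Least in blast)
  have jM: "j \<le> M" using j(1) by (simp add: M_def le_degree)
  have rec: "coeff q j * fps_nth f (n + (M - j)) = - (\<Sum>i\<in>{j<..M}. coeff q i * fps_nth f (n + (M - i)))"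
    if "n \<ge> N + K" for n
  proof -
    have "v (n - K + M) = (\<Sum>i\<le>M. coeff q i * fps_nth f (n + (M - i)))"
      unfolding v_def using that
      by (intro sum.cong refl arg_cong2[of _ _ _ _ "(*)"] arg_cong[of _ _ "fps_nth f"]) auto
    also have "\<dots> = (\<Sum>i\<in>{j..M}. coeff q i * fps_nth f (n + (M - i)))"
      using j(2) by (intro sum.mono_neutral_right) auto
    also have "\<dots> = coeff q j * fps_nth f (n + (M - j)) + (\<Sum>i\<in>{j<..M}. coeff q i * fps_nth f (n + (M - i)))"
      using jM by (simp add: sum.head)
    finally show ?thesis using N[of "n - K + M"] that by (simp add: eq_neg_iff_add_eq_0)
  qed
  show ?thesis
  proof (rule deterministic_window_imp_eventually_periodic[OF fin])
    fix m n assume mn: "m \<ge> N + K" "n \<ge> N + K"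
      and eq: "\<And>i. i < M - j \<Longrightarrow> fps_nth f (m + i) = fps_nth f (n + i)"
    have "(\<Sum>i\<in>{j<..M}. coeff q i * fps_nth f (m + (M - i))) = (\<Sum>i\<in>{j<..M}. coeff q i * fps_nth f (n + (M - i)))"
      by (intro sum.cong refl arg_cong2[of _ _ _ _ "(*)"] eq) auto
    then have "coeff q j * fps_nth f (m + (M - j)) = coeff q j * fps_nth f (n + (M - j))"
      using rec mn by simp
    then show "fps_nth f (m + (M - j)) = fps_nth f (n + (M - j))" using j(1) by simp
  qed
qed

section \<open>The series of the word and its rational form\<close>

text \<open>The weights are \<open>0\<close> and \<open>-1\<close>, so that \<open>t\<^sub>n = |I\<^sub>1| n + (|I\<^sub>1| - |I\<^sub>2|) \<Sum>\<^bsub>k<n\<^esub> weight(w\<^sub>k)\<close>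
  carries the sign of the theorem.\<close>

definition letter_weight :: "letter \<Rightarrow> 'a::comm_ring_1" where
  "letter_weight a = (case a of a1 \<Rightarrow> 0 | a2 \<Rightarrow> - 1)"

definition letter_series :: "(nat \<Rightarrow> letter) \<Rightarrow> complex fps" where
  "letter_series w = Abs_fps (\<lambda>n. letter_weight (w n))"

definition letter_sum_series :: "(nat \<Rightarrow> letter) \<Rightarrow> complex fps" where
  "letter_sum_series w = Abs_fps (\<lambda>n. \<Sum>k<n. letter_weight (w k))"

lemma letter_sum_series_mult: "letter_sum_series w * (1 - fps_X) = fps_X * letter_series w"
proof (rule fps_ext)
  fix n show "fps_nth (letter_sum_series w * (1 - fps_X)) n = fps_nth (fps_X * letter_series w) n"
    by (cases n) (simp_all add: letter_sum_series_def letter_series_def right_diff_distrib)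
qed

text \<open>Multiplication by 1 - X takes differences: the first one turns the sequence n into a
  shifted constant 1, the second leaves only X.\<close>

lemma Abs_fps_of_nat_mult: "Abs_fps of_nat * (1 - fps_X)\<^sup>2 = (fps_X :: complex fps)"
proof -
  have 1: "Abs_fps of_nat * (1 - fps_X) = (fps_X * Abs_fps (\<lambda>_. 1) :: complex fps)"
  proof (rule fps_ext)
    fix n show "fps_nth (Abs_fps of_nat * (1 - fps_X)) n = fps_nth (fps_X * Abs_fps (\<lambda>_. 1) :: complex fps) n"
      by (cases n) (simp_all add: right_diff_distrib)
  qed
  have 2: "Abs_fps (\<lambda>_. 1) * (1 - fps_X) = (1 :: complex fps)"
  proof (rule fps_ext)
    fix n show "fps_nth (Abs_fps (\<lambda>_. 1) * (1 - fps_X)) n = fps_nth (1 :: complex fps) n"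
      by (cases n) (simp_all add: right_diff_distrib)
  qed
  show ?thesis
    by (simp add: power2_eq_square 1 2 mult.assoc flip: mult.assoc[of "Abs_fps of_nat"])
qed

lemma gen_series_decomposition:
  "gen_series L1 L2 w = fps_const (of_real (L1 - L2)) * letter_sum_series w
     + fps_const (of_real L1) * Abs_fps of_nat"
proof (rule fps_ext)
  fix n
  have "geom_real L1 L2 w n = (L1 - L2) * (\<Sum>k<n. letter_weight (w k)) + L1 * of_nat n"
    by (induction n)
       (auto simp: geom_real_def tile_len_def letter_weight_def algebra_simps split: letter.split)
  moreover have "complex_of_real (letter_weight a) = letter_weight a" for a
    by (cases a) (simp_all add: letter_weight_def)
  ultimately show "fps_nth (gen_series L1 L2 w) n = fps_nth (fps_const (of_real (L1 - L2)) * letter_sum_series w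
     + fps_const (of_real L1) * Abs_fps of_nat) n"
    by (simp add: gen_series_def letter_sum_series_def)
qed

text \<open>Multiplication by 1 - X^d takes differences over \<open>d\<close> steps, which vanish
  from \<open>N + d\<close> on; this leaves a polynomial.\<close>

lemma eventually_periodic_letter_series:
  assumes "eventually_periodic w"
  obtains P :: "rat poly" and d where "d \<ge> 1"
    "letter_series w * (1 - fps_X ^ d) = fps_of_poly (map_poly of_rat P)"
proof -
  obtain N d where d: "d \<ge> 1" "\<And>n. n \<ge> N \<Longrightarrow> w (n + d) = w n"
    using assms unfolding eventually_periodic_def by blast
  \<comment> \<open>The value 0 for \<open>n < d\<close> reflects that the series shifted by
    \<open>d\<close> has no terms there.\<close>
  define p :: "nat \<Rightarrow> rat" where
    "p n = letter_weight (w n) - (if n < d then 0 else letter_weight (w (n - d)))" for n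
  define P where "P = Poly (map p [0..<N + d])"
  have p0: "p n = 0" if "n \<ge> N + d" for n
    using d(2)[of "n - d"] that by (simp add: p_def)
  have weight: "of_rat (letter_weight a) = (letter_weight a :: complex)" for a
    by (cases a) (simp_all add: letter_weight_def)
  have "letter_series w * (1 - fps_X ^ d) = fps_of_poly (map_poly of_rat P)"
  proof (rule fps_ext)
    fix n
    have "coeff P n = p n"
      using p0[of n] by (auto simp: P_def nth_default_def)
    then show "fps_nth (letter_series w * (1 - fps_X ^ d)) n = fps_nth (fps_of_poly (map_poly of_rat P)) n"
      by (simp add: right_diff_distrib fps_X_power_mult_right_nth letter_series_def
          coeff_map_poly p_def of_rat_diff weight)
  qed
  with d(1) that show ?thesis by blast
qed

text \<open>Clearing the denominators of the decomposition expresses the letter series through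
  \<open>G\<close>, so algebraicity of \<open>G\<close> yields a differential equation for a series
  with only two coefficient values.\<close>

lemma not_transcendental_QX_imp_eventually_periodic:
  assumes "L1 \<noteq> L2" "\<not> transcendental_QX (gen_series L1 L2 w)"
  shows "eventually_periodic w"
proof -
  define G where "G = gen_series L1 L2 w"
  obtain P :: "rat poly poly" where P: "P \<noteq> 0"
    "poly (map_poly (\<lambda>q. fps_of_poly (map_poly of_rat q)) P) G = 0"
    using assms(2) unfolding transcendental_QX_def G_def by blast
  define Q :: "complex poly poly" where "Q = map_poly (map_poly of_rat) P"
  have "Q \<noteq> 0"
  proof
    have "coeff (coeff Q i) j = of_rat (coeff (coeff P i) j)" for i j
      by (simp add: Q_def coeff_map_poly)
    moreover assume "Q = 0"
    ultimately show False using P(1) by (simp add: poly_eq_iff)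
  qed
  have Q0: "poly_eval_fps G Q = 0"
    using P(2) by (simp add: poly_eval_fps_def Q_def map_poly_map_poly o_def)
  \<comment> \<open>This is (L1 - L2) X (1 - X), the factor of the letter series in (1 - X)^2 G; it
    is nonzero because the lengths differ.\<close>
  define e where "e = [:0, of_real (L1 - L2), - of_real (L1 - L2) :: complex:]"
  have e: "fps_of_poly e = fps_const (of_real (L1 - L2)) * (fps_X * (1 - fps_X))"
    by (simp add: e_def fps_of_poly_pCons algebra_simps)
  have "e \<noteq> 0" using assms(1) by (simp add: e_def)
  have "(1 - fps_X)\<^sup>2 * G = fps_const (of_real (L1 - L2)) * (1 - fps_X) * (letter_sum_series w * (1 - fps_X))
      + fps_const (of_real L1) * (Abs_fps of_nat * (1 - fps_X)\<^sup>2)"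
    unfolding G_def gen_series_decomposition by (simp add: power2_eq_square algebra_simps)
  moreover have lin: "fps_of_poly [:1, -1:] = (1 - fps_X :: complex fps)"
    "fps_of_poly [:0, of_real L1:] = fps_const (of_real L1 :: complex) * fps_X"
    by (simp_all add: fps_of_poly_pCons mult.commute flip: fps_const_neg)
  ultimately have "fps_of_poly e * letter_series w
      = fps_of_poly ([:1, -1:]\<^sup>2) * G - fps_of_poly [:0, of_real L1:]"
    unfolding letter_sum_series_mult Abs_fps_of_nat_mult e lin by (simp add: fps_of_poly_power mult_ac lin)
  also have "\<dots> \<in> range (poly_eval_fps G)"
    by (rule poly_eval_fps_closed(5)[OF poly_eval_fps_closed(4)]) (rule poly_eval_fps_closed(1,2))+
  finally have eh: "fps_of_poly e * letter_series w \<in> range (poly_eval_fps G)" .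
  obtain c d where "\<exists>k\<le>d. c k \<noteq> 0"
    "(\<Sum>k\<le>d. fps_of_poly (c k) * (fps_deriv ^^ k) (letter_series w)) = 0"
    using algebraic_fps_imp_linear_ode[OF \<open>Q \<noteq> 0\<close> Q0 _ poly_eval_fps_closed(1) eh] \<open>e \<noteq> 0\<close>
    by auto
  moreover have "finite (range (fps_nth (letter_series w)))"
    by (rule finite_subset[of _ "{0, - 1}"])
       (auto simp: letter_series_def letter_weight_def split: letter.splits)
  ultimately have "eventually_periodic (fps_nth (letter_series w))"
    by (intro finite_range_linear_ode_imp_eventually_periodic)
  \<comment> \<open>The two weights differ, so a period of the coefficients is a period of the
    word.\<close>
  moreover have "fps_nth (letter_series w) m = fps_nth (letter_series w) n \<longleftrightarrow> w m = w n" for m n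
    by (auto simp: letter_series_def letter_weight_def split: letter.splits)
  ultimately show ?thesis by (simp add: eventually_periodic_def)
qed

section \<open>The three cases\<close>

theorem theorem4p9:
  fixes \<sigma> :: "letter \<Rightarrow> letter list" and w :: "nat \<Rightarrow> letter" and L1 L2 :: real
  assumes "fixed_word \<sigma> w"
    and "L1 > 0" and "L2 > 0"
    and "algebraic L1" and "algebraic L2"
  defines "G \<equiv> gen_series L1 L2 w"
  shows "(L1 = L2 \<and>
            G = fps_const (of_real L1) * fps_X / (1 - fps_X)^2)
       \<or> (L1 \<noteq> L2 \<and> eventually_periodic w \<and>
            (\<exists>(P :: rat poly) (d :: nat). d \<ge> 1 \<and>
               G = fps_const (of_real (L1 - L2)) * (fps_X * fps_of_poly (map_poly of_rat P))
                     / ((1 - fps_X) * (1 - fps_X ^ d))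
                   + fps_const (of_real L1) * fps_X / (1 - fps_X)^2))
       \<or> (L1 \<noteq> L2 \<and> \<not> eventually_periodic w \<and> transcendental_QX G)"
proof -
  have X: "1 - fps_X \<noteq> (0 :: complex fps)"
    by simp
  have linear: "fps_const (of_real L1) * Abs_fps of_nat
      = fps_const (of_real L1) * fps_X / (1 - fps_X :: complex fps)\<^sup>2"
    using nonzero_mult_div_cancel_right[of "(1 - fps_X :: complex fps)\<^sup>2" "fps_const (of_real L1) * Abs_fps of_nat"] X
    by (simp add: mult.assoc Abs_fps_of_nat_mult)
  consider "L1 = L2" | "L1 \<noteq> L2" "eventually_periodic w" | "L1 \<noteq> L2" "\<not> eventually_periodic w"
    by blast
  then show ?thesis
  proof cases
    case 1
    then have "G = fps_const (of_real L1) * Abs_fps of_nat"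
      by (simp add: G_def gen_series_decomposition)
    with 1 linear show ?thesis by simp
  next
    case 2
    obtain P :: "rat poly" and d where P: "d \<ge> 1"
      "letter_series w * (1 - fps_X ^ d) = fps_of_poly (map_poly of_rat P)"
      using eventually_periodic_letter_series[OF 2(2)] .
    \<comment> \<open>As \<open>d \<ge> 1\<close>, the constant term is 1; this makes the
      denominator nonzero and allows cancellation.\<close>
    have "fps_nth (1 - fps_X ^ d :: complex fps) 0 \<noteq> 0" using P(1) by simp
    then have Xd: "1 - fps_X ^ d \<noteq> (0 :: complex fps)" by (intro notI) simp
    have "fps_const (of_real (L1 - L2)) * (fps_X * fps_of_poly (map_poly of_rat P))
        = fps_const (of_real (L1 - L2)) * letter_sum_series w * ((1 - fps_X) * (1 - fps_X ^ d))"
      unfolding P(2)[symmetric]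
      by (simp only: mult.assoc[symmetric] letter_sum_series_mult mult.assoc[of _ "letter_sum_series w"])
    then have "fps_const (of_real (L1 - L2)) * letter_sum_series w
        = fps_const (of_real (L1 - L2)) * (fps_X * fps_of_poly (map_poly of_rat P))
            / ((1 - fps_X) * (1 - fps_X ^ d))"
      using X Xd by (simp only: nonzero_mult_div_cancel_right mult_eq_0_iff simp_thms)
    then have "G = fps_const (of_real (L1 - L2)) * (fps_X * fps_of_poly (map_poly of_rat P))
          / ((1 - fps_X) * (1 - fps_X ^ d)) + fps_const (of_real L1) * fps_X / (1 - fps_X)\<^sup>2"
      by (simp only: G_def gen_series_decomposition linear)
    with P(1) 2 show ?thesis by blast
  next
    case 3
    then show ?thesis
      using not_transcendental_QX_imp_eventually_periodic G_def by blast
  qed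
qed

end
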